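(* The monoid ${\cal RM}^{n+o(n)}$ is non-regular. In fact, there exists a real-time function in ${\cal RM}^{n+o(n)}$ that has no inverse in ${\cal RM}^{n+o(n)}$.
   Context: Let $A=\{0,1\}$, $A^*$ the set of all finite words over $A$, $|x|$ the length of $x$. "Function" means partial function. A right ideal is a set $R\subseteq A^*$ with $RA^*=R$. A right-ideal morphism is a partial function $h:A^*\to A^*$ such that ${\sf Dom}(h)$ is a right ideal and $h(xw)=h(x)\,w$ for all $x\in{\sf Dom}(h)$, $w\in A^*$. ${\cal RM}^{\sf P}$ is the monoid (under composition) of all right-ideal morphisms $f$ of $A^*$ that are computable by deterministic Turing machines in polynomial time and are polynomially balanced (there is a polynomial $p$ with $|f(x)|\le p(|x|)$ and $|x|\le p(|f(x)|)$ for all $x\in{\sf Dom}(f)$). A total function $t:{\mathbb N}\to{\mathbb N}$ is said to be $n+o(n)$ iff there is a total function $\epsilon:{\mathbb N}\to{\mathbb R}_{\ge0}$ with $\lim_{n\to\infty}\epsilon(n)=0$ and $t(n)\le n+\epsilon(n)\cdot n$ for all $n$. An ${\cal RM}^{\sf P}$-machine is a deterministic multi-tape Turing machine $M$ with a read-only input-tape and a write-only output-tape, such that the input-tape head and the output-tape head never move left. It has an accept state; when $M$ halts, the content of the output-tape is a valid output iff $M$ is in the accept state (otherwise the output is undefined). Let $f_M$ be the input-output function of $M$. It is assumed that for every $x\in{\sf Dom}(f_M)$ and $z\in A^*$, in the computation of $M$ on input $xz$ the input-tape head does not start reading $z$ until $f_M(x)$ has been written on the output-tape (to read a letter means to make a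 transition whose input-tape letter is this letter). ${\cal RM}^{n+o(n)}$ is the set of all $f\in{\cal RM}^{\sf P}$ that can be computed by an ${\cal RM}^{\sf P}$-machine whose input-output balance and time-complexity are $n+o(n)$; i.e., for some function $t$ that is $n+o(n)$ and all $x\in{\sf Dom}(f)$: $|f(x)|\le t(|x|)$, $|x|\le t(|f(x)|)$, and the running time on $x$ is $\le t(|x|)$. The time bound is only assumed on inputs $x\in{\sf Dom}(f)$. This set is a submonoid of ${\cal RM}^{\sf P}$. A function is real-time if it is computed by such a machine with running time $\le n+c$ for some constant $c\ge0$, where $n$ is the input length. An inverse of $f$ is an $f'$ with $f f' f=f$; a monoid is regular iff each of its elements has an inverse in the monoid. *)

theory Defs
  imports
    Complex_Main
    "HOL-Computational_Algebra.Polynomial"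
    "HOL-Algebra.Group"
begin

section \<open>Words and right-ideal morphisms\<close>

text \<open>The alphabet \<open>{0,1}\<close> is \<^typ>\<open>bool\<close>; partial functions on words are maps.\<close>

type_synonym word = "bool list"

definition right_ideal :: "word set \<Rightarrow> bool" where
  "right_ideal R \<longleftrightarrow> {x @ w | x w. x \<in> R} = R"

definition right_ideal_morphism :: "(word \<rightharpoonup> word) \<Rightarrow> bool" where
  "right_ideal_morphism h \<longleftrightarrow>
     right_ideal (dom h) \<and>
     (\<forall>x\<in>dom h. \<forall>w. h (x @ w) = Some (the (h x) @ w))"


section \<open>Deterministic multi-tape Turing machines\<close>

datatype symbol = Blank | Letter bool | Aux nat

datatype move = MoveLeft | Stay | MoveRight

text \<open>
  A tape is a two-way infinite sequence of cells together with a head position.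
  An action on a tape optionally writes a symbol on the scanned cell (\<open>None\<close> leaves the cell
  unchanged) and then moves the head. Tape 0 is the input-tape, tape 1 the output-tape,
  all others are work-tapes. A machine halts when the transition function yields \<open>None\<close>.
\<close>

type_synonym tape = "(int \<Rightarrow> symbol) \<times> int"
type_synonym action = "symbol option \<times> move"
type_synonym config = "nat \<times> tape list"

record machine =
  num_tapes :: nat
  states :: "nat set"
  alphabet :: "symbol set"
  start_state :: nat
  accept_state :: nat
  delta :: "nat \<Rightarrow> symbol list \<Rightarrow> (nat \<times> action list) option"

definition scans :: "machine \<Rightarrow> symbol list set" where
  "scans M = {ss. length ss = num_tapes M \<and> set ss \<subseteq> alphabet M}"

definition turing_machine :: "machine \<Rightarrow> bool" where
  "turing_machine M \<longleftrightarrow>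
     2 \<le> num_tapes M \<and>
     finite (states M) \<and> start_state M \<in> states M \<and> accept_state M \<in> states M \<and>
     finite (alphabet M) \<and> {Blank, Letter False, Letter True} \<subseteq> alphabet M \<and>
     (\<forall>q\<in>states M. \<forall>ss\<in>scans M. \<forall>q' acts. delta M q ss = Some (q', acts) \<longrightarrow>
        q' \<in> states M \<and> length acts = num_tapes M \<and>
        (\<forall>(w, m)\<in>set acts. \<forall>s. w = Some s \<longrightarrow> s \<in> alphabet M))"

fun shift :: "move \<Rightarrow> int" where
  "shift MoveLeft = - 1"
| "shift Stay = 0"
| "shift MoveRight = 1"

fun act :: "tape \<Rightarrow> action \<Rightarrow> tape" where
  "act (t, h) (w, m) = (case w of None \<Rightarrow> t | Some s \<Rightarrow> t(h := s), h + shift m)"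

fun step :: "machine \<Rightarrow> config \<Rightarrow> config option" where
  "step M (q, tps) =
     (case delta M q (map (\<lambda>(t, h). t h) tps) of
        None \<Rightarrow> None
      | Some (q', acts) \<Rightarrow> Some (q', map2 act tps acts))"

definition word_tape :: "word \<Rightarrow> int \<Rightarrow> symbol" where
  "word_tape x = (\<lambda>i. if 0 \<le> i \<and> i < int (length x) then Letter (x ! nat i) else Blank)"

definition init :: "machine \<Rightarrow> word \<Rightarrow> config" where
  "init M x = (start_state M, (word_tape x, 0) # replicate (num_tapes M - 1) (\<lambda>_. Blank, 0))"

text \<open>The configuration after exactly \<open>n\<close> transitions; \<open>None\<close> if \<open>M\<close> has halted earlier.\<close>

fun run :: "machine \<Rightarrow> word \<Rightarrow> nat \<Rightarrow> config option" where
  "run M x 0 = Some (init M x)"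
| "run M x (Suc n) = Option.bind (run M x n) (step M)"

definition halts_in :: "machine \<Rightarrow> word \<Rightarrow> nat \<Rightarrow> config \<Rightarrow> bool" where
  "halts_in M x n c \<longleftrightarrow> run M x n = Some c \<and> step M c = None"

definition input_head :: "config \<Rightarrow> int" where
  "input_head c = snd (snd c ! 0)"

definition output_content :: "config \<Rightarrow> int \<Rightarrow> symbol" where
  "output_content c = fst (snd c ! 1)"

text \<open>\<open>outputs M x y\<close> expresses \<open>f\<^sub>M(x) = y\<close> for the input-output function \<open>f\<^sub>M\<close> of \<open>M\<close>.\<close>

definition outputs :: "machine \<Rightarrow> word \<Rightarrow> word \<Rightarrow> bool" where
  "outputs M x y \<longleftrightarrow>
     (\<exists>n c. halts_in M x n c \<and> fst c = accept_state M \<and> output_content c = word_tape y)"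

definition computes :: "machine \<Rightarrow> (word \<rightharpoonup> word) \<Rightarrow> bool" where
  "computes M f \<longleftrightarrow> (\<forall>x y. f x = Some y \<longleftrightarrow> outputs M x y)"

definition runs_within :: "machine \<Rightarrow> word \<Rightarrow> nat \<Rightarrow> bool" where
  "runs_within M x b \<longleftrightarrow> (\<exists>n c. halts_in M x n c \<and> n \<le> b)"


section \<open>The monoid of polynomial-time, polynomially balanced right-ideal morphisms\<close>

definition poly_time_computable :: "(word \<rightharpoonup> word) \<Rightarrow> bool" where
  "poly_time_computable f \<longleftrightarrow>
     (\<exists>M (p :: nat poly). turing_machine M \<and> computes M f \<and>
        (\<forall>x. runs_within M x (poly p (length x))))"

definition poly_balanced :: "(word \<rightharpoonup> word) \<Rightarrow> bool" where
  "poly_balanced f \<longleftrightarrow>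
     (\<exists>p :: nat poly. \<forall>x y. f x = Some y \<longrightarrow>
        length y \<le> poly p (length x) \<and> length x \<le> poly p (length y))"

definition RM_P :: "(word \<rightharpoonup> word) set" where
  "RM_P = {f. right_ideal_morphism f \<and> poly_time_computable f \<and> poly_balanced f}"


section \<open>One-way machines with delayed reading\<close>

definition read_only_one_way_input :: "machine \<Rightarrow> bool" where
  "read_only_one_way_input M \<longleftrightarrow>
     (\<forall>q\<in>states M. \<forall>ss\<in>scans M. \<forall>q' acts. delta M q ss = Some (q', acts) \<longrightarrow>
        fst (acts ! 0) = None \<and> snd (acts ! 0) \<noteq> MoveLeft)"

definition write_only_one_way_output :: "machine \<Rightarrow> bool" where
  "write_only_one_way_output M \<longleftrightarrow>
     (\<forall>q\<in>states M. \<forall>ss\<in>scans M.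
        (\<forall>s\<in>alphabet M. delta M q (ss[1 := s]) = delta M q ss) \<and>
        (\<forall>q' acts. delta M q ss = Some (q', acts) \<longrightarrow> snd (acts ! 1) \<noteq> MoveLeft))"

text \<open>
  On input \<open>x @ z\<close>, transition number \<open>i\<close> is made with the input-tape head on a letter of \<open>z\<close>.
  A configuration in which the machine halts makes no transition, hence reads nothing.
\<close>

definition reads_suffix :: "machine \<Rightarrow> word \<Rightarrow> word \<Rightarrow> nat \<Rightarrow> bool" where
  "reads_suffix M x z i \<longleftrightarrow>
     (\<exists>c. run M (x @ z) i = Some c \<and> step M c \<noteq> None \<and>
        int (length x) \<le> input_head c \<and> input_head c < int (length (x @ z)))"

definition has_written :: "config \<Rightarrow> word \<Rightarrow> bool" where
  "has_written c y \<longleftrightarrow> (\<forall>j < length y. output_content c (int j) = Letter (y ! j))"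

definition RM_machine :: "machine \<Rightarrow> bool" where
  "RM_machine M \<longleftrightarrow>
     turing_machine M \<and> read_only_one_way_input M \<and> write_only_one_way_output M \<and>
     (\<forall>x y z i. outputs M x y \<and> reads_suffix M x z i \<and> (\<forall>j<i. \<not> reads_suffix M x z j) \<longrightarrow>
        has_written (the (run M (x @ z) i)) y)"


section \<open>Time and balance \<open>n + o(n)\<close>\<close>

definition n_plus_o_n :: "(nat \<Rightarrow> nat) \<Rightarrow> bool" where
  "n_plus_o_n t \<longleftrightarrow>
     (\<exists>\<epsilon> :: nat \<Rightarrow> real. (\<forall>n. 0 \<le> \<epsilon> n) \<and> \<epsilon> \<longlonglongrightarrow> 0 \<and>
        (\<forall>n. real (t n) \<le> real n + \<epsilon> n * real n))"

definition RM_n_o_n :: "(word \<rightharpoonup> word) set" where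
  "RM_n_o_n = {f \<in> RM_P. \<exists>M t. RM_machine M \<and> computes M f \<and> n_plus_o_n t \<and>
     (\<forall>x y. f x = Some y \<longrightarrow>
        length y \<le> t (length x) \<and> length x \<le> t (length y) \<and> runs_within M x (t (length x)))}"

definition real_time :: "(word \<rightharpoonup> word) \<Rightarrow> bool" where
  "real_time f \<longleftrightarrow>
     (\<exists>M c. RM_machine M \<and> computes M f \<and> (\<forall>x\<in>dom f. runs_within M x (length x + c)))"


section \<open>Regularity\<close>

definition RM_n_o_n_monoid :: "(word \<rightharpoonup> word) monoid" where
  "RM_n_o_n_monoid = \<lparr>carrier = RM_n_o_n, mult = (\<circ>\<^sub>m), one = Some\<rparr>"

definition is_inverse :: "('a, 'b) monoid_scheme \<Rightarrow> 'a \<Rightarrow> 'a \<Rightarrow> bool" where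
  "is_inverse G f f' \<longleftrightarrow> f \<otimes>\<^bsub>G\<^esub> f' \<otimes>\<^bsub>G\<^esub> f = f"

definition regular :: "('a, 'b) monoid_scheme \<Rightarrow> bool" where
  "regular G \<longleftrightarrow> (\<forall>f\<in>carrier G. \<exists>f'\<in>carrier G. is_inverse G f f')"

end

theory Submission
  imports Defs
begin

text \<open>
  The witness \<open>unannounce\<close> maps \<open>c 0\<^sup>k 1 c z\<close> to \<open>0\<^sup>k 1 c z\<close>: the input announces the bit \<open>c\<close> in
  its first letter, repeats it behind the marker \<open>1\<close>, and the function erases the announcement. A
  finite automaton can copy its input while checking that the two occurrences of \<open>c\<close> agree, so the
  function is real-time.

  The function is injective, so an inverse must send \<open>0\<^sup>k 1 c\<close> to \<open>c 0\<^sup>k 1 c\<close>. Now \<open>c\<close> is the first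
  letter to be written but the last letter to be read. On the two inputs \<open>0\<^sup>k 1 c\<close> a machine goes
  through the same configurations during its first \<open>k + 1\<close> transitions
  (\<open>run_common_prefix\<close>). If by then the output head has left the first cell, that cell holds
  the same letter for both inputs for ever, because the head never goes back, and one of the outputs
  is wrong. If it is still on the first cell, it needs \<open>k + 2\<close> further transitions to
  reach the end of the output (\<open>output_tape_run\<close>). The running time is therefore at least
  \<open>2 k + 3\<close> for inputs of length \<open>k + 2\<close>, which is not \<open>n + o(n)\<close>
  (\<open>announcing_takes_double_time\<close>).
\<close>

section \<open>Runs of machines\<close>

(* Unfolded, every statement about a transition becomes a case distinction on its outcome. *)
declare step.simps [simp del]

lemma word_tape_inj: "word_tape x = word_tape y \<longleftrightarrow> x = y"
proof
  assume eq: "word_tape x = word_tape y"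
  have nonblank: "word_tape w (int i) \<noteq> Blank \<longleftrightarrow> i < length w" for w i
    by (simp add: word_tape_def)
  have len: "length x = length y"
    using nonblank[of x] nonblank[of y] eq by (metis linorder_neqE_nat less_irrefl)
  show "x = y"
  proof (rule nth_equalityI[OF len])
    fix i assume "i < length x"
    then show "x ! i = y ! i"
      using fun_cong[OF eq, of "int i"] len by (simp add: word_tape_def)
  qed
qed simp

lemma word_tape_Nil: "word_tape [] = (\<lambda>_. Blank)"
  by (rule ext) (simp add: word_tape_def)

lemma word_tape_snoc:
  "(word_tape w)(int (length w) := Letter b) = word_tape (w @ [b])"
  by (rule ext) (auto simp: word_tape_def nth_append nat_less_iff)

lemma run_earlier:
  assumes "run M x (i + d) = Some c"
  obtains c' where "run M x i = Some c'"
  using assms by (induction d arbitrary: c) (auto split: bind_splits)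

lemma runs_withinI:
  assumes "run M x (Suc n) = None"
  shows "runs_within M x n"
  using assms
proof (induction n)
  case 0
  then show ?case by (simp add: runs_within_def halts_in_def del: split_paired_Ex)
next
  case (Suc n)
  show ?case
  proof (cases "run M x (Suc n)")
    case None
    then show ?thesis
      using Suc.IH by (meson runs_within_def le_SucI)
  next
    case (Some c)
    then have "step M c = None"
      using Suc.prems by simp
    with Some show ?thesis
      unfolding runs_within_def halts_in_def by blast
  qed
qed

lemma halts_in_unique:
  assumes "halts_in M x m c" "halts_in M x n d"
  shows "m = n"
proof -
  have False if m: "halts_in M x m c" and n: "halts_in M x n d" and "m < n" for m n c d
  proof -
    obtain e where "n = Suc m + e"
      using \<open>m < n\<close> less_iff_Suc_add by auto
    then obtain c' where "run M x (Suc m) = Some c'"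
      using n run_earlier[of M x "Suc m" e d] unfolding halts_in_def by blast
    then show False
      using m by (simp add: halts_in_def)
  qed
  then show ?thesis
    using assms by (metis linorder_neqE_nat)
qed

text \<open>
  The axioms on a transition function only speak about states, symbols and tape
  numbers of the machine, so every use of them along a run requires this invariant.
\<close>

definition proper_config :: "machine \<Rightarrow> config \<Rightarrow> bool" where
  "proper_config M c \<longleftrightarrow> fst c \<in> states M \<and> length (snd c) = num_tapes M \<and>
     (\<forall>tp\<in>set (snd c). range (fst tp) \<subseteq> alphabet M)"

lemma proper_config_scans:
  "proper_config M (q, tps) \<Longrightarrow> map (\<lambda>(t, h). t h) tps \<in> scans M"
  by (fastforce simp: proper_config_def scans_def)

lemma proper_config_init:
  assumes "turing_machine M"
  shows "proper_config M (init M x)"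
proof -
  have "Letter b \<in> alphabet M" for b
    using assms by (cases b) (auto simp: turing_machine_def)
  with assms show ?thesis
    by (auto simp: turing_machine_def proper_config_def init_def word_tape_def)
qed

lemma step_cases:
  assumes "turing_machine M" "proper_config M c" "step M c = Some c'"
  obtains q acts where "delta M (fst c) (map (\<lambda>(t, h). t h) (snd c)) = Some (q, acts)"
    "c' = (q, map2 act (snd c) acts)" "length acts = num_tapes M" "q \<in> states M"
    "\<And>a s. a \<in> set acts \<Longrightarrow> fst a = Some s \<Longrightarrow> s \<in> alphabet M"
proof -
  obtain p tps where c: "c = (p, tps)" by force
  obtain q acts where qa: "delta M p (map (\<lambda>(t, h). t h) tps) = Some (q, acts)"
    "c' = (q, map2 act tps acts)"
    using assms(3) by (auto simp: c step.simps split: option.splits)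
  have "p \<in> states M" using assms(2) by (simp add: proper_config_def c)
  moreover have "map (\<lambda>(t, h). t h) tps \<in> scans M"
    using assms(2) by (simp add: c proper_config_scans)
  moreover have "\<forall>q\<in>states M. \<forall>ss\<in>scans M. \<forall>q' acts. delta M q ss = Some (q', acts) \<longrightarrow>
      q' \<in> states M \<and> length acts = num_tapes M \<and>
      (\<forall>(w, m)\<in>set acts. \<forall>s. w = Some s \<longrightarrow> s \<in> alphabet M)"
    using assms(1) by (simp add: turing_machine_def)
  ultimately have ok: "q \<in> states M \<and> length acts = num_tapes M \<and>
      (\<forall>(w, m)\<in>set acts. \<forall>s. w = Some s \<longrightarrow> s \<in> alphabet M)"
    using qa(1) by blast
  show thesis
  proof (rule that[of q acts])
    fix a s
    assume "a \<in> set acts" "fst a = Some s"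
    then show "s \<in> alphabet M"
      using ok by (cases a) auto
  qed (use qa ok in \<open>simp_all only: c fst_conv snd_conv\<close>)
qed

lemma fst_act:
  "fst (act tp a) = (case fst a of None \<Rightarrow> fst tp | Some s \<Rightarrow> (fst tp)(snd tp := s))"
  by (cases tp; cases a) (simp split: option.split)

lemma snd_act: "snd (act tp a) = snd tp + shift (snd a)"
  by (cases tp; cases a) simp

lemma shift_le: "shift m \<le> 1"
  by (cases m) auto

lemma shift_ge: "m \<noteq> MoveLeft \<Longrightarrow> 0 \<le> shift m"
  by (cases m) auto

lemma proper_config_step:
  assumes "turing_machine M" "proper_config M c" "step M c = Some c'"
  shows "proper_config M c'"
  using step_cases[OF assms]
proof cases
  case (1 q acts)
  have "range (fst (act (fst p) (snd p))) \<subseteq> alphabet M"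
    if p: "p \<in> set (zip (snd c) acts)" for p
  proof -
    have "(fst p, snd p) \<in> set (zip (snd c) acts)"
      using p by simp
    note mem = set_zip_leftD[OF this] set_zip_rightD[OF this]
    have cells: "fst (fst p) j \<in> alphabet M" for j
      using mem(1) assms(2) by (auto simp: proper_config_def)
    show ?thesis
      by (cases "fst (snd p)") (auto simp: fst_act cells 1(5)[OF mem(2)])
  qed
  then have "\<forall>tp\<in>set (map2 act (snd c) acts). range (fst tp) \<subseteq> alphabet M"
    by (simp only: set_map ball_simps(9) case_prod_beta) blast
  moreover have "length (map2 act (snd c) acts) = num_tapes M"
    using assms(2) 1(3) by (simp add: proper_config_def)
  ultimately show ?thesis
    unfolding proper_config_def 1(2) fst_conv snd_conv by (intro conjI 1(4))
qed

lemma proper_config_run: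
  assumes "turing_machine M" "run M x i = Some c"
  shows "proper_config M c"
  using assms(2)
proof (induction i arbitrary: c)
  case 0
  then show ?case using proper_config_init[OF assms(1)] by auto
next
  case (Suc i)
  then obtain d where d: "run M x i = Some d" "step M d = Some c"
    by (auto simp: bind_eq_Some_conv)
  show ?case
    by (rule proper_config_step[OF assms(1) Suc.IH[OF d(1)] d(2)])
qed


section \<open>What a slow reader can write\<close>

definition output_head :: "config \<Rightarrow> int" where
  "output_head c = snd (snd c ! 1)"

lemma output_tape_step:
  assumes "turing_machine M" "write_only_one_way_output M" "proper_config M c"
    and "step M c = Some c'"
  shows "output_head c \<le> output_head c'" "output_head c' \<le> output_head c + 1"
    and "j \<noteq> output_head c \<Longrightarrow> output_content c' j = output_content c j"
proof -
  obtain q acts where 1: "delta M (fst c) (map (\<lambda>(t, h). t h) (snd c)) = Some (q, acts)"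
    "c' = (q, map2 act (snd c) acts)" "length acts = num_tapes M"
    by (rule step_cases[OF assms(1,3,4)], rule that)
  have len: "1 < length (snd c)" "1 < length acts"
    using assms(1,3) 1(3) by (auto simp: turing_machine_def proper_config_def)
  then have tape: "snd c' ! 1 = act (snd c ! 1) (acts ! 1)"
    by (simp add: 1(2))
  have "map (\<lambda>(t, h). t h) (snd c) \<in> scans M"
    using assms(3) by (cases c) (simp add: proper_config_scans)
  moreover have "fst c \<in> states M"
    using assms(3) by (simp add: proper_config_def)
  ultimately have "snd (acts ! 1) \<noteq> MoveLeft"
    using assms(2) 1(1) unfolding write_only_one_way_output_def by blast
  then show "output_head c \<le> output_head c'" "output_head c' \<le> output_head c + 1"
    "j \<noteq> output_head c \<Longrightarrow> output_content c' j = output_content c j"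
    using shift_le[of "snd (acts ! 1)"] shift_ge[of "snd (acts ! 1)"]
    unfolding output_head_def output_content_def tape fst_act snd_act
    by (simp_all split: option.split)
qed

text \<open>
  A one-way output head never returns to a cell that it has left, and it cannot have written
  on a cell that it has not reached. The first fact makes early output final, the second one makes
  long output slow.
\<close>

lemma output_tape_run:
  assumes "turing_machine M" "write_only_one_way_output M"
    and "run M x i = Some c" "run M x (i + d) = Some c'"
  shows "output_head c \<le> output_head c'" "output_head c' \<le> output_head c + int d"
    and "j < output_head c \<or> output_head c' < j \<Longrightarrow> output_content c' j = output_content c j"
proof -
  have "output_head c \<le> output_head c' \<and> output_head c' \<le> output_head c + int d \<and>
      (\<forall>j. j < output_head c \<or> output_head c' < j \<longrightarrow> output_content c' j = output_content c j)"
    using assms(4)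
  proof (induction d arbitrary: c')
    case 0
    then show ?case using assms(3) by simp
  next
    case (Suc d)
    then obtain e where e: "run M x (i + d) = Some e" "step M e = Some c'"
      by (auto simp: bind_eq_Some_conv)
    note st = output_tape_step[OF assms(1,2) proper_config_run[OF assms(1) e(1)] e(2)]
    show ?case
      using Suc.IH[OF e(1)] st(1,2) st(3) by fastforce
  qed
  then show "output_head c \<le> output_head c'" "output_head c' \<le> output_head c + int d"
    "j < output_head c \<or> output_head c' < j \<Longrightarrow> output_content c' j = output_content c j"
    by blast+
qed

definition same_up_to :: "int \<Rightarrow> config \<Rightarrow> config \<Rightarrow> bool" where
  "same_up_to n c d \<longleftrightarrow> fst c = fst d \<and> tl (snd c) = tl (snd d) \<and> input_head c = input_head d \<and>
     (\<forall>j<n. fst (snd c ! 0) j = fst (snd d ! 0) j)"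

lemma same_up_to_step:
  assumes M: "turing_machine M" "proper_config M c" "proper_config M d"
    and same: "same_up_to n c d" and head: "input_head c < n"
    and st: "step M c = Some c'" "step M d = Some d'"
  shows "same_up_to n c' d'" "input_head c' \<le> input_head c + 1"
proof -
  from M have "snd c \<noteq> []" "snd d \<noteq> []"
    by (auto simp: turing_machine_def proper_config_def)
  then obtain q t h rest q2 u h2 rest2
    where "c = (q, (t, h) # rest)" "d = (q2, (u, h2) # rest2)"
    by (metis neq_Nil_conv prod.collapse)
  then have cd: "c = (q, (t, h) # rest)" "d = (q, (u, h) # rest)"
    and eq: "\<And>j. j < n \<Longrightarrow> t j = u j" and h: "h < n"
    using same head by (simp_all add: same_up_to_def input_head_def)
  obtain q' acts where 1: "delta M q (map (\<lambda>(t, h). t h) ((t, h) # rest)) = Some (q', acts)"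
    "c' = (q', map2 act ((t, h) # rest) acts)" "length acts = num_tapes M"
    by (rule step_cases[OF M(1,2) st(1), unfolded cd fst_conv snd_conv], rule that)
  obtain a as where acts: "acts = a # as"
    using 1(3) M(1) by (cases acts) (auto simp: turing_machine_def)
  have d': "d' = (q', map2 act ((u, h) # rest) acts)"
    using st(2) 1(1) eq[OF h] by (simp add: cd step.simps)
  show "same_up_to n c' d'" "input_head c' \<le> input_head c + 1"
    using eq shift_le
    by (auto simp: same_up_to_def input_head_def 1(2) d' acts cd fst_act snd_act
        simp del: act.simps split: option.splits)
qed

text \<open>
  Since the input head advances by at most one cell per transition, a machine needs more
  than \<open>|p|\<close> transitions to make use of what follows the prefix \<open>p\<close>.
\<close>

lemma run_common_prefix:
  assumes M: "turing_machine M" and "i \<le> length p"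
    and "run M (p @ u) i = Some c" "run M (p @ v) i = Some d"
  shows "same_up_to (int (length p)) c d"
proof -
  have "same_up_to (int (length p)) c d \<and> input_head c \<le> int i"
    using assms(2-)
  proof (induction i arbitrary: c d)
    case 0
    then show ?case
      by (auto simp: init_def same_up_to_def input_head_def word_tape_def nth_append)
  next
    case (Suc i)
    then obtain c0 d0 where "run M (p @ u) i = Some c0" "step M c0 = Some c"
      "run M (p @ v) i = Some d0" "step M d0 = Some d"
      by (auto simp: bind_eq_Some_conv)
    with Suc.IH[of c0 d0] Suc.prems(1) show ?case
      using same_up_to_step[OF M, of c0 d0 "int (length p)" c d] proper_config_run[OF M]
      by fastforce
  qed
  then show ?thesis ..
qed

text \<open>
  The first output letters \<open>a\<close> and \<open>b\<close> differ, but nothing before the end of \<open>p\<close> tells the two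
  inputs apart. So the output head cannot leave its first cell during the first \<open>|p|\<close> transitions:
  reading \<open>p\<close> and writing the rest of the output are consecutive, and their times add up.
\<close>

lemma announcing_takes_double_time:
  assumes M: "turing_machine M" "write_only_one_way_output M"
    and out: "outputs M (p @ u) (a # y)" "outputs M (p @ v) (b # z)" and "a \<noteq> b"
    and len: "length p \<le> length y" "length p \<le> length z"
    and within: "runs_within M (p @ u) s" "runs_within M (p @ v) s"
  shows "length p + min (length y) (length z) \<le> s"
proof -
  \<comment> \<open>The output head has to reach the last letter of the output.\<close>
  have final: "\<exists>n c. run M x n = Some c \<and> n \<le> s \<and> output_content c 0 = Letter a \<and>
      int (length y) \<le> output_head c \<and> length y \<le> n"
    if "outputs M x (a # y)" "runs_within M x s" for x a y
  proof -
    obtain n c where c: "halts_in M x n c" "output_content c = word_tape (a # y)"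
      using \<open>outputs M x (a # y)\<close> by (auto simp: outputs_def)
    have n: "run M x n = Some c" "n \<le> s"
      using c(1) \<open>runs_within M x s\<close> halts_in_unique
      unfolding runs_within_def halts_in_def by metis+
    have tape: "snd (init M x) ! 1 = ((\<lambda>_. Blank), 0)"
      using M(1) by (auto simp: init_def turing_machine_def)
    note from_init = output_tape_run[OF M, of x 0 "init M x" n c]
    have "int (length y) \<le> output_head c"
    proof (rule ccontr)
      assume "\<not> ?thesis"
      then have "output_content c (int (length y)) = Blank"
        using from_init(3)[of "int (length y)"] n(1) tape by (simp add: output_content_def)
      then show False
        by (simp add: c(2) word_tape_def)
    qed
    moreover have "output_head c \<le> int n"
      using from_init(2) n(1) tape by (simp add: output_head_def)
    ultimately show ?thesis
      using n c(2) by (intro exI[of _ n] exI[of _ c]) (simp add: word_tape_def)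
  qed
  obtain m c where c: "run M (p @ u) m = Some c" "m \<le> s" "output_content c 0 = Letter a"
      "int (length y) \<le> output_head c" "length y \<le> m"
    using final[OF out(1) within(1)] by blast
  obtain n d where d: "run M (p @ v) n = Some d" "n \<le> s" "output_content d 0 = Letter b"
      "int (length z) \<le> output_head d" "length z \<le> n"
    using final[OF out(2) within(2)] by blast
  obtain m' where m': "m = length p + m'"
    using c(5) len le_Suc_ex by (meson le_trans)
  obtain n' where n': "n = length p + n'"
    using d(5) len le_Suc_ex by (meson le_trans)
  obtain c0 where c0: "run M (p @ u) (length p) = Some c0"
    using c(1) m' run_earlier by blast
  obtain d0 where d0: "run M (p @ v) (length p) = Some d0"
    using d(1) n' run_earlier by blast
  have "tl (snd c0) = tl (snd d0)"
    using run_common_prefix[OF M(1) _ c0 d0] by (simp add: same_up_to_def)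
  moreover have "tl (snd e) ! 0 = snd e ! 1" if "run M x i = Some e" for x i e
    using proper_config_run[OF M(1) that] M(1)
    by (simp add: proper_config_def turing_machine_def nth_tl)
  ultimately have "snd c0 ! 1 = snd d0 ! 1"
    using c0 d0 by metis
  then have same: "output_head c0 = output_head d0" "output_content c0 = output_content d0"
    by (simp_all add: output_head_def output_content_def)
  note cr = output_tape_run[OF M c0 c(1)[unfolded m']]
  note dr = output_tape_run[OF M d0 d(1)[unfolded n']]
  \<comment> \<open>Otherwise the first cell would have been left while it had the same content in both runs.\<close>
  have "output_head c0 \<le> 0"
  proof (rule ccontr)
    assume "\<not> ?thesis"
    then have "output_content c 0 = output_content d 0"
      using cr(3)[of 0] dr(3)[of 0] same by simp
    then show False
      using c(3) d(3) \<open>a \<noteq> b\<close> by (metis symbol.inject(1))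
  qed
  then show ?thesis
    using cr(2) c(2,4) m' by linarith
qed


section \<open>The function that erases an announced bit\<close>

definition announced :: "word set" where
  "announced = {c # replicate k False @ True # c # z | c k z. True}"

definition unannounce :: "word \<rightharpoonup> word" where
  "unannounce x = (if x \<in> announced then Some (tl x) else None)"

text \<open>
  State 0 expects the announcement, states 1 and 2 remember it while reading the zeros,
  states 3 and 4 expect its repetition, and in state 5 it has been confirmed.
\<close>

definition next_state :: "nat \<Rightarrow> bool \<Rightarrow> nat option" where
  "next_state q b =
     (if q = 0 then Some (if b then 2 else 1)
      else if q = 1 \<or> q = 2 then Some (if b then q + 2 else q)
      else if q = 3 then (if b then None else Some 5)
      else if q = 4 then (if b then Some 5 else None)
      else if q = 5 then Some 5 else None)"

fun track :: "nat \<Rightarrow> word \<Rightarrow> nat option" where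
  "track q [] = Some q"
| "track q (b # x) = Option.bind (next_state q b) (\<lambda>q'. track q' x)"

lemma track_append: "track q (x @ y) = Option.bind (track q x) (\<lambda>q'. track q' y)"
  by (induction x arbitrary: q) (auto split: bind_splits)

lemma track_confirmed: "track 5 x = Some 5"
  by (induction x) (auto simp: next_state_def)

lemma track_remembering:
  "track (if c then 2 else 1) x = Some 5 \<longleftrightarrow> (\<exists>k z. x = replicate k False @ True # c # z)"
proof (induction x)
  case Nil
  then show ?case by auto
next
  case (Cons b x)
  show ?case
  proof (cases b)
    case True
    have "(True # x = replicate k False @ True # c # z) \<longleftrightarrow> k = 0 \<and> x = c # z" for k z
      by (cases k) auto
    moreover have "next_state (if c then 2 else 1) True = Some (if c then 4 else 3)"
      by (simp add: next_state_def)
    moreover have "track (if c then 4 else 3) x = Some 5 \<longleftrightarrow> (\<exists>z. x = c # z)"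
      by (cases x) (auto simp: next_state_def track_confirmed split: bind_splits)
    ultimately show ?thesis
      using True by (simp split del: if_split)
  next
    case False
    have "(\<exists>k z. b # x = replicate k False @ True # c # z) \<longleftrightarrow>
        (\<exists>k z. x = replicate k False @ True # c # z)" (is "?l \<longleftrightarrow> ?r")
    proof
      assume ?l
      then obtain k z where "b # x = replicate k False @ True # c # z" by blast
      then show ?r using False by (cases k) auto
    next
      assume ?r
      then obtain k z where "x = replicate k False @ True # c # z" by blast
      then have "b # x = replicate (Suc k) False @ True # c # z" using False by simp
      then show ?l by blast
    qed
    moreover have "next_state (if c then 2 else 1) False = Some (if c then 2 else 1)"
      by (simp add: next_state_def)
    ultimately show ?thesis
      using False Cons.IH by (simp split del: if_split)
  qed
qed

lemma track_announced: "track 0 x = Some 5 \<longleftrightarrow> x \<in> announced"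
proof (cases x)
  case Nil
  then show ?thesis by (simp add: announced_def)
next
  case (Cons b y)
  then show ?thesis
    using track_remembering[of b y] by (simp add: announced_def next_state_def)
qed

lemma announced_append: "x \<in> announced \<Longrightarrow> x @ w \<in> announced"
  unfolding track_announced[symmetric] by (simp add: track_append track_confirmed)

lemma right_ideal_morphism_unannounce: "right_ideal_morphism unannounce"
proof -
  have dom: "dom unannounce = announced"
    by (auto simp: unannounce_def split: if_splits)
  have "right_ideal announced"
    using announced_append by (force simp: right_ideal_def intro: exI[of _ "[]"])
  moreover have "unannounce (x @ w) = Some (the (unannounce x) @ w)" if "x \<in> announced" for x w
    using that announced_append[OF that, of w] by (auto simp: unannounce_def announced_def)
  ultimately show ?thesis
    by (simp add: right_ideal_morphism_def dom)
qed

lemma poly_balanced_unannounce: "poly_balanced unannounce"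
  unfolding poly_balanced_def
  by (rule exI[of _ "[:1, 1:]"]) (auto simp: unannounce_def split: if_splits)

text \<open>
  The announcement can be recovered from the image because the marker, the first \<open>1\<close>, locates the
  repetition of \<open>c\<close>. Hence an inverse has no freedom on words of this form.
\<close>

lemma unannounce_preimage:
  assumes "unannounce v = Some (replicate k False @ [True, c])"
  shows "v = c # replicate k False @ [True, c]"
proof -
  obtain b l z where v: "v = b # replicate l False @ True # b # z"
    and eq: "replicate l False @ True # b # z = replicate k False @ [True, c]"
    using assms by (auto simp: unannounce_def announced_def split: if_splits)
  have "takeWhile Not (replicate n False @ True # y) = replicate n False" for n y
    by (induction n) auto
  with eq have "replicate l False = replicate k False" by metis
  then have "l = k" by (metis length_replicate)
  with eq v show ?thesis by simp
qed


section \<open>A real-time machine for the function\<close>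

definition eraser :: machine where
  "eraser = \<lparr>num_tapes = 2, states = {..5}, alphabet = {Blank, Letter False, Letter True},
     start_state = 0, accept_state = 5,
     delta = (\<lambda>q ss. case ss ! 0 of
         Letter b \<Rightarrow> map_option (\<lambda>q'. (q', [(None, MoveRight),
           if q = 0 then (None, Stay) else (Some (Letter b), MoveRight)])) (next_state q b)
       | _ \<Rightarrow> None)\<rparr>"

lemma eraser_sel [simp]:
  "num_tapes eraser = 2" "states eraser = {..5}"
  "alphabet eraser = {Blank, Letter False, Letter True}"
  "start_state eraser = 0" "accept_state eraser = 5"
  by (simp_all add: eraser_def)

lemma next_state_le: "next_state q b = Some q' \<Longrightarrow> 0 < q' \<and> q' \<le> 5"
  by (auto simp: next_state_def split: if_splits)

lemma delta_eraser:
  "delta eraser q ss = Some (q', acts) \<longleftrightarrow>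
     (\<exists>b. ss ! 0 = Letter b \<and> next_state q b = Some q' \<and>
       acts = [(None, MoveRight), if q = 0 then (None, Stay) else (Some (Letter b), MoveRight)])"
  by (auto simp: eraser_def split: symbol.splits)

lemma turing_machine_eraser: "turing_machine eraser"
  by (auto simp: turing_machine_def delta_eraser dest: next_state_le split: if_splits)

lemma step_eraser:
  "step eraser (q, [(word_tape x, int i), tp]) =
     (if i < length x then map_option (\<lambda>q'. (q', [(word_tape x, int (Suc i)),
        if q = 0 then tp else act tp (Some (Letter (x ! i)), MoveRight)])) (next_state q (x ! i))
      else None)"
  by (cases tp) (auto simp: step.simps eraser_def word_tape_def split: option.splits)

lemma track_start: "track 0 x = Some 0 \<longleftrightarrow> x = []"
  by (induction x rule: rev_induct) (auto simp: track_append split: bind_splits dest: next_state_le)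

text \<open>
  After \<open>i\<close> transitions the output lags behind the input by exactly the announcement,
  which produces no output; \<open>i - 1\<close> is truncated at \<open>i = 0\<close>.
\<close>

lemma run_eraser:
  assumes "i \<le> length x"
  shows "run eraser x i = map_option (\<lambda>q. (q, [(word_tape x, int i),
    (word_tape (tl (take i x)), int (i - 1))])) (track 0 (take i x))"
  using assms
proof (induction i)
  case 0
  then show ?case by (simp add: init_def word_tape_Nil)
next
  case (Suc i)
  then have i: "i < length x" by simp
  have tk: "take (Suc i) x = take i x @ [x ! i]"
    using i by (rule take_Suc_conv_app_nth)
  show ?case
  proof (cases "track 0 (take i x)")
    case None
    then show ?thesis using Suc by (simp add: tk track_append)
  next
    case (Some q)
    let ?out = "(word_tape (tl (take i x)), int (i - 1))"
    have IH: "run eraser x i = Some (q, [(word_tape x, int i), ?out])"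
      using Suc Some by simp
    have tape: "(if q = 0 then ?out else act ?out (Some (Letter (x ! i)), MoveRight))
        = (word_tape (tl (take (Suc i) x)), int (Suc i - 1))"
    proof (cases "i = 0")
      case True
      then show ?thesis
        using Some by (cases x) simp_all
    next
      case False
      with i have "take i x \<noteq> []" by auto
      then have "q \<noteq> 0" using Some track_start[of "take i x"] by auto
      then show ?thesis
        using word_tape_snoc[of "tl (take i x)" "x ! i"] i False \<open>take i x \<noteq> []\<close>
        by (simp add: tk min_def)
    qed
    have "run eraser x (Suc i) = step eraser (q, [(word_tape x, int i), ?out])"
      by (simp add: IH)
    also have "\<dots> = map_option (\<lambda>q'. (q', [(word_tape x, int (Suc i)),
        (word_tape (tl (take (Suc i) x)), int (Suc i - 1))])) (next_state q (x ! i))"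
      by (simp only: step_eraser i if_True tape)
    also have "next_state q (x ! i) = track 0 (take (Suc i) x)"
      by (simp add: tk track_append Some)
    finally show ?thesis .
  qed
qed

text \<open>
  Behind the input there is a blank, on which no transition is defined. This bounds the running
  time for all inputs, those outside the domain included.
\<close>

lemma run_eraser_end: "length x < i \<Longrightarrow> run eraser x i = None"
proof (induction i)
  case (Suc i)
  then show ?case
    by (cases "i = length x")
      (auto simp: run_eraser step_eraser split: bind_splits)
qed simp

lemma runs_within_eraser: "runs_within eraser x (length x)"
  using run_eraser_end by (intro runs_withinI) blast

lemma outputs_eraser: "outputs eraser x y \<longleftrightarrow> unannounce x = Some y"
proof
  assume "outputs eraser x y"
  then obtain n c where n: "run eraser x n = Some c" "step eraser c = None" "fst c = 5"
    "output_content c = word_tape y"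
    by (auto simp: outputs_def halts_in_def)
  have le: "n \<le> length x"
    using n(1) run_eraser_end by (metis linorder_not_less option.distinct(1))
  have tr: "track 0 (take n x) = Some 5"
    and c: "c = (5, [(word_tape x, int n), (word_tape (tl (take n x)), int (n - 1))])"
    using n(1,3) run_eraser[OF le] by auto
  \<comment> \<open>The accepting state has a successor for each letter, so the whole input has been read.\<close>
  have "n = length x"
    using n(2) le by (auto simp: c step_eraser next_state_def split: if_splits)
  then show "unannounce x = Some y"
    using tr n(4) c by (simp add: unannounce_def track_announced output_content_def word_tape_inj)
next
  assume "unannounce x = Some y"
  then have "track 0 x = Some 5" "y = tl x"
    by (auto simp: unannounce_def track_announced split: if_splits)
  then have "halts_in eraser x (length x)
      (5, [(word_tape x, int (length x)), (word_tape y, int (length x - 1))])"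
    by (simp add: halts_in_def run_eraser step_eraser)
  then show "outputs eraser x y"
    unfolding outputs_def
    by (intro exI conjI, assumption) (simp_all add: output_content_def)
qed

lemma RM_machine_eraser: "RM_machine eraser"
proof -
  have "read_only_one_way_input eraser"
    by (auto simp: read_only_one_way_input_def delta_eraser)
  moreover have "write_only_one_way_output eraser"
    by (auto simp: write_only_one_way_output_def delta_eraser) (simp add: eraser_def)+
  moreover have "has_written (the (run eraser (x @ z) i)) y"
    if out: "outputs eraser x y" and reads: "reads_suffix eraser x z i" for x y z i
  proof -
    from out have y: "y = tl x" "x \<noteq> []"
      by (auto simp: outputs_eraser unannounce_def announced_def split: if_splits)
    obtain c where c: "run eraser (x @ z) i = Some c"
      "int (length x) \<le> input_head c" "input_head c < int (length (x @ z))"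
      using reads by (auto simp: reads_suffix_def)
    have le: "i \<le> length (x @ z)"
      using c(1) run_eraser_end by (metis linorder_not_less option.distinct(1))
    have "input_head c = int i" "output_content c = word_tape (tl (take i (x @ z)))"
      using c(1) run_eraser[OF le] by (auto simp: input_head_def output_content_def)
    then show ?thesis
      using c y by (auto simp: has_written_def word_tape_def nth_append min_def)
  qed
  ultimately show ?thesis
    using turing_machine_eraser by (auto simp: RM_machine_def)
qed

lemma computes_eraser: "computes eraser unannounce"
  by (simp add: computes_def outputs_eraser)

lemma real_time_unannounce: "real_time unannounce"
  unfolding real_time_def
  by (intro exI[of _ eraser] exI[of _ 0])
    (simp add: RM_machine_eraser computes_eraser runs_within_eraser)

lemma poly_time_computable_unannounce: "poly_time_computable unannounce"
  unfolding poly_time_computable_def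
  by (intro exI[of _ eraser] exI[of _ "[:0, 1:]"])
    (simp add: turing_machine_eraser computes_eraser runs_within_eraser)

text \<open>
  Erasing one letter requires the balance \<open>n + 1\<close>, but every \<open>t\<close> of the form \<open>n + o(n)\<close> has
  \<open>t(0) = 0\<close>.
\<close>

lemma unannounce_in_RM_n_o_n: "unannounce \<in> RM_n_o_n"
proof -
  define t :: "nat \<Rightarrow> nat" where "t n = (if n = 0 then 0 else n + 1)" for n
  have "n_plus_o_n t"
    unfolding n_plus_o_n_def
    by (rule exI[of _ "\<lambda>n. 1 / real n"]) (auto simp: t_def lim_1_over_n)
  moreover have "length y \<le> t (length x) \<and> length x \<le> t (length y) \<and>
      runs_within eraser x (t (length x))" if "unannounce x = Some y" for x y
  proof -
    have "runs_within eraser x (length x + 1)"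
      using runs_within_eraser by (meson runs_within_def trans_le_add1)
    with that show ?thesis
      by (auto simp: unannounce_def announced_def t_def split: if_splits)
  qed
  ultimately show ?thesis
    using right_ideal_morphism_unannounce poly_time_computable_unannounce
      poly_balanced_unannounce RM_machine_eraser computes_eraser
    unfolding RM_n_o_n_def RM_P_def by blast
qed


section \<open>Non-regularity\<close>

lemma unannounce_no_inverse:
  assumes g: "g \<in> RM_n_o_n"
  shows "unannounce \<circ>\<^sub>m g \<circ>\<^sub>m unannounce \<noteq> unannounce"
proof
  assume inv: "unannounce \<circ>\<^sub>m g \<circ>\<^sub>m unannounce = unannounce"
  obtain M t where M: "RM_machine M" "computes M g" "n_plus_o_n t"
    and tM: "\<And>x y. g x = Some y \<Longrightarrow> runs_within M x (t (length x))"
    using g by (auto simp: RM_n_o_n_def)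
  from M(1) have tm: "turing_machine M" "write_only_one_way_output M"
    by (auto simp: RM_machine_def)
  obtain \<epsilon> where eps: "\<epsilon> \<longlonglongrightarrow> 0" "\<And>n. real (t n) \<le> real n + \<epsilon> n * real n"
    using M(3) by (auto simp: n_plus_o_n_def)
  have "\<forall>\<^sub>F n in sequentially. \<epsilon> n < 1 / 2"
    using eps(1) by (rule order_tendstoD) simp
  then obtain N where N: "\<And>n. n \<ge> N \<Longrightarrow> \<epsilon> n < 1 / 2"
    by (auto simp: eventually_sequentially)
  \<comment> \<open>The term \<open>N\<close> gives \<open>t(k + 2) \<le> 3/2 (k + 2)\<close>, and \<open>k > 0\<close> makes \<open>2 k + 3\<close> exceed this bound.\<close>
  define k where "k = N + 1"
  let ?p = "replicate k False @ [True]"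
  have g_val: "g (?p @ [c]) = Some (c # ?p @ [c])" for c
  proof -
    have "c # ?p @ [c] \<in> announced"
      unfolding announced_def by auto
    then have f: "unannounce (c # ?p @ [c]) = Some (?p @ [c])"
      by (simp add: unannounce_def)
    have "(unannounce \<circ>\<^sub>m g \<circ>\<^sub>m unannounce) (c # ?p @ [c]) = Some (?p @ [c])"
      unfolding inv by (rule f)
    then obtain v where "g (?p @ [c]) = Some v" "unannounce v = Some (?p @ [c])"
      using f by (auto simp: map_comp_def split: option.splits)
    then show ?thesis
      using unannounce_preimage[of v k c] by simp
  qed
  then have out: "outputs M (?p @ [c]) (c # ?p @ [c])" for c
    using M(2) unfolding computes_def by blast
  have within: "runs_within M (?p @ [c]) (t (k + 2))" for c
    using tM[OF g_val, of c] by simp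
  have "length ?p + min (length (?p @ [False])) (length (?p @ [True])) \<le> t (k + 2)"
    by (rule announcing_takes_double_time[OF tm out out _ _ _ within within]) auto
  then have "2 * real k + 3 \<le> real (t (k + 2))"
    by simp
  also have "\<dots> \<le> real (k + 2) + \<epsilon> (k + 2) * real (k + 2)"
    by (rule eps(2))
  also have "\<dots> \<le> real (k + 2) + 1 / 2 * real (k + 2)"
    using N[of "k + 2"] by (intro add_left_mono mult_right_mono) (auto simp: k_def)
  finally show False
    by (simp add: k_def)
qed

theorem proposition6p2:
  "\<not> regular RM_n_o_n_monoid \<and>
   (\<exists>f\<in>carrier RM_n_o_n_monoid. real_time f \<and>
      \<not> (\<exists>f'\<in>carrier RM_n_o_n_monoid. is_inverse RM_n_o_n_monoid f f'))"
proof -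
  have "unannounce \<in> carrier RM_n_o_n_monoid"
    by (simp add: RM_n_o_n_monoid_def unannounce_in_RM_n_o_n)
  moreover have "\<not> is_inverse RM_n_o_n_monoid unannounce g" if "g \<in> carrier RM_n_o_n_monoid" for g
    using that unannounce_no_inverse by (simp add: RM_n_o_n_monoid_def is_inverse_def)
  ultimately show ?thesis
    using real_time_unannounce unfolding regular_def by blast
qed

end
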